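(* Let $v\neq4$ and let $\mathcal D$ be a block design with parameters $(v,b,r,k,\lambda)$ on $V$ with blocks $B_1,\dots,B_b$. Let $$\mathcal Q_4=\{S\subseteq V\;:\;|S|=4\ \text{ and }\ |S\cap B_j|\equiv0\ (\mathrm{mod}\ 2)\ \text{ for all }\ 1\leqslant j\leqslant b\}.$$ Then $\mathcal P(\mathcal D)$ is a system of pairs with parameters $(v,n,t)$ (for some $n,t$) if and only if either $\mathcal Q_4=\emptyset$ (then $\mathcal P(\mathcal D)$ is the trivial system, $t=1$), or $\mathcal Q_4$ is the block set of a block design on $V$, necessarily with parameters $v_4=v$, $k_4=4$, $\lambda_4=t-1>0$. In that case all subsystems of $\mathcal P(\mathcal D)$ have size $t=1+\lambda_4$.
   Context: A block design with parameters $(v,b,r,k,\lambda)$ (with $b,r,k,\lambda$ positive integers and $k<v$) on a finite set $V$ with $|V|=v$ is a collection (repetitions allowed) of $b$ blocks $B_1,\dots,B_b$, each a $k$-element subset of $V$, such that every element of $V$ lies in exactly $r$ blocks and every pair of distinct elements of $V$ is contained in exactly $\lambda$ blocks. For an unordered pair $\{x,y\}$ of distinct elements of $V$, let $\mathcal Z^+(x,y)\in\{0,1\}^b$ be the vector with $j$th entry $|\chi_{B_j}(x)-\chi_{B_j}(y)|$, where $\chi_B$ is the characteristic function of $B$. Two unordered pairs are equivalent with respect to $\mathcal D$, written $\{x,y\}\sim_{\mathcal D}\{\alpha,\beta\}$, if $\mathcal Z^+(x,y)=\mathcal Z^+(\alpha,\beta)$. The set of equivalence classes of $\sim_{\mathcal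 D}$ on the set of unordered pairs of distinct elements of $V$ is denoted $\mathcal P(\mathcal D)$. A system of pairs with parameters $(v,n,t)$ on $V$ is a partition of all $\frac{v(v-1)}2$ unordered pairs of distinct elements of $V$ into $n$ families (subsystems) of $t$ pairs each ($n,t\geqslant1$, $nt=\frac{v(v-1)}2$) such that no subsystem contains any element of $V$ more than once. It is trivial if $t=1$. Saying that $\mathcal P(\mathcal D)$ is a system of pairs means that its classes are the subsystems of a system of pairs. *)

theory Defs
  imports "HOL-Library.FuncSet" "HOL-Library.Disjoint_Sets" "HOL-Library.Indicator_Function"
begin

text \<open>
  The blocks are the family \<open>B 1, \<dots>, B b\<close>, so that repeated blocks are allowed; the values of
  \<open>B\<close> outside \<open>{1..b}\<close> are irrelevant.
\<close>

definition block_design ::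
    "'a set \<Rightarrow> nat \<Rightarrow> nat \<Rightarrow> nat \<Rightarrow> nat \<Rightarrow> nat \<Rightarrow> (nat \<Rightarrow> 'a set) \<Rightarrow> bool" where
  "block_design V v b r k l B \<longleftrightarrow>
     b > 0 \<and> r > 0 \<and> k > 0 \<and> l > 0 \<and> k < v \<and>
     finite V \<and> card V = v \<and>
     (\<forall>j\<in>{1..b}. B j \<subseteq> V \<and> card (B j) = k) \<and>
     (\<forall>x\<in>V. card {j\<in>{1..b}. x \<in> B j} = r) \<and>
     (\<forall>x\<in>V. \<forall>y\<in>V. x \<noteq> y \<longrightarrow> card {j\<in>{1..b}. {x, y} \<subseteq> B j} = l)"

text \<open>
  A set \<open>\<B>\<close> is the block set of a design if it can be enumerated without repetitions so as to
  give the blocks of a design.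
\<close>

definition block_set_of_design ::
    "'a set \<Rightarrow> nat \<Rightarrow> nat \<Rightarrow> nat \<Rightarrow> nat \<Rightarrow> nat \<Rightarrow> 'a set set \<Rightarrow> bool" where
  "block_set_of_design V v b r k l \<B> \<longleftrightarrow>
     (\<exists>B. bij_betw B {1..b} \<B> \<and> block_design V v b r k l B)"

definition unordered_pairs :: "'a set \<Rightarrow> 'a set set" where
  "unordered_pairs V = {{x, y} | x y. x \<in> V \<and> y \<in> V \<and> x \<noteq> y}"

text \<open>Vectors of length \<open>b\<close> are extensional functions on \<open>{1..b}\<close>.\<close>

definition Zplus :: "nat \<Rightarrow> (nat \<Rightarrow> 'a set) \<Rightarrow> 'a \<Rightarrow> 'a \<Rightarrow> nat \<Rightarrow> int" where
  "Zplus b B x y = (\<lambda>j\<in>{1..b}. \<bar>indicator (B j) x - indicator (B j) y\<bar>)"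

lemma Zplus_commute: "Zplus b B x y = Zplus b B y x"
  by (simp add: Zplus_def abs_minus_commute)

definition pair_equiv :: "'a set \<Rightarrow> nat \<Rightarrow> (nat \<Rightarrow> 'a set) \<Rightarrow> 'a set rel" where
  "pair_equiv V b B =
     {(p, q). p \<in> unordered_pairs V \<and> q \<in> unordered_pairs V \<and>
        (\<exists>x y \<alpha> \<beta>. p = {x, y} \<and> q = {\<alpha>, \<beta>} \<and> Zplus b B x y = Zplus b B \<alpha> \<beta>)}"

text \<open>By symmetry of \<^const>\<open>Zplus\<close>, the choice of representatives does not matter.\<close>

lemma pair_equiv_iff:
  "({x, y}, {\<alpha>, \<beta>}) \<in> pair_equiv V b B \<longleftrightarrow>
     {x, y} \<in> unordered_pairs V \<and> {\<alpha>, \<beta>} \<in> unordered_pairs V \<and>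
     Zplus b B x y = Zplus b B \<alpha> \<beta>"
  unfolding pair_equiv_def by (auto simp: doubleton_eq_iff) (metis Zplus_commute)+

lemma equiv_pair_equiv: "equiv (unordered_pairs V) (pair_equiv V b B)"
proof (rule equivI)
  show "pair_equiv V b B \<subseteq> unordered_pairs V \<times> unordered_pairs V"
    by (auto simp: pair_equiv_def)
  show "refl_on (unordered_pairs V) (pair_equiv V b B)"
    by (auto simp: refl_on_def pair_equiv_def unordered_pairs_def)
  show "sym (pair_equiv V b B)"
    unfolding sym_def pair_equiv_def by (clarsimp, metis)
  show "trans (pair_equiv V b B)"
  proof (rule transI)
    fix p q s assume a: "(p, q) \<in> pair_equiv V b B" "(q, s) \<in> pair_equiv V b B"
    then obtain x y \<alpha> \<beta> \<gamma> \<delta> where "p = {x, y}" "q = {\<alpha>, \<beta>}" "s = {\<gamma>, \<delta>}"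
      by (auto simp: pair_equiv_def)
    with a show "(p, s) \<in> pair_equiv V b B"
      by (simp add: pair_equiv_iff)
  qed
qed

definition pair_classes :: "'a set \<Rightarrow> nat \<Rightarrow> (nat \<Rightarrow> 'a set) \<Rightarrow> 'a set set set" where
  "pair_classes V b B = unordered_pairs V // pair_equiv V b B"

definition system_of_pairs :: "'a set \<Rightarrow> nat \<Rightarrow> nat \<Rightarrow> nat \<Rightarrow> 'a set set set \<Rightarrow> bool" where
  "system_of_pairs V v n t \<S> \<longleftrightarrow>
     finite V \<and> card V = v \<and> n \<ge> 1 \<and> t \<ge> 1 \<and> n * t = v * (v - 1) div 2 \<and>
     partition_on (unordered_pairs V) \<S> \<and> card \<S> = n \<and>
     (\<forall>C\<in>\<S>. card C = t \<and> disjoint C)"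

definition trivial_system_of_pairs :: "'a set \<Rightarrow> nat \<Rightarrow> 'a set set set \<Rightarrow> bool" where
  "trivial_system_of_pairs V v \<S> \<longleftrightarrow> (\<exists>n. system_of_pairs V v n 1 \<S>)"

definition even_quadruples :: "'a set \<Rightarrow> nat \<Rightarrow> (nat \<Rightarrow> 'a set) \<Rightarrow> 'a set set" where
  "even_quadruples V b B =
     {S. S \<subseteq> V \<and> card S = 4 \<and> (\<forall>j\<in>{1..b}. even (card (S \<inter> B j)))}"

end

theory Submission
  imports Defs
begin

text \<open>
  Two points of a block design are always separated by some block. Hence two distinct equivalent
  pairs are disjoint, and disjoint pairs \<open>p\<close>, \<open>q\<close> are equivalent iff \<open>p \<union> q\<close> is an even quadruple.
  So the class of \<open>p\<close> has one element more than there are even quadruples containing \<open>p\<close>, and the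
  classes form a system of pairs iff this number does not depend on \<open>p\<close>. If it is positive, counting
  the points other than \<open>x\<close> on the quadruples through \<open>x\<close> shows that every point lies on the same
  number of quadruples.
\<close>

section \<open>Counting pairs, and designs described by their set of blocks\<close>

lemma card_unordered_pairs:
  assumes "finite V"
  shows "card (unordered_pairs V) = card V * (card V - 1) div 2"
proof -
  have "unordered_pairs V = {p. p \<subseteq> V \<and> card p = 2}"
    by (auto simp: unordered_pairs_def card_2_iff)
  then show ?thesis
    using n_subsets[OF assms, of 2] by (simp add: choose_two)
qed

lemma finite_unordered_pairs: "finite V \<Longrightarrow> finite (unordered_pairs V)"
  by (rule finite_subset[of _ "Pow V"]) (auto simp: unordered_pairs_def)

lemma finite_even_quadruples: "finite V \<Longrightarrow> finite (even_quadruples V b B)"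
  by (rule finite_subset[of _ "Pow V"]) (auto simp: even_quadruples_def)

text \<open>An enumeration without repetitions turns counts of indices into counts of members of
  \<open>Q\<close>. The resulting conditions no longer mention \<open>B\<close>, so every
  enumeration of \<open>Q\<close> serves equally well.\<close>

lemma block_set_of_design_iff:
  "block_set_of_design V v b r k l Q \<longleftrightarrow>
     b > 0 \<and> r > 0 \<and> k > 0 \<and> l > 0 \<and> k < v \<and> finite V \<and> card V = v \<and> finite Q \<and> card Q = b \<and>
     (\<forall>S\<in>Q. S \<subseteq> V \<and> card S = k) \<and>
     (\<forall>x\<in>V. card {S\<in>Q. x \<in> S} = r) \<and>
     (\<forall>x\<in>V. \<forall>y\<in>V. x \<noteq> y \<longrightarrow> card {S\<in>Q. {x, y} \<subseteq> S} = l)"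
  (is "_ \<longleftrightarrow> ?R")
proof -
  have count: "card {j\<in>{1..b}. P (B j)} = card {S\<in>Q. P S}"
    if "bij_betw B {1..b} Q" for B P
  proof -
    have "B ` {j\<in>{1..b}. P (B j)} = {S\<in>Q. P S}"
      unfolding bij_betw_imp_surj_on[OF that, symmetric] by blast
    then have "bij_betw B {j\<in>{1..b}. P (B j)} {S\<in>Q. P S}"
      by (intro bij_betw_subset[OF that]) blast+
    then show ?thesis by (rule bij_betw_same_card)
  qed
  \<comment> \<open>Serves both directions below: for the enumeration given by the definition, and
    for an arbitrary one chosen because \<open>card Q = b\<close>.\<close>
  have eq: "block_design V v b r k l B \<longleftrightarrow> ?R" if "bij_betw B {1..b} Q" for B
  proof -
    have "finite Q" "card Q = b"
      using bij_betw_finite[OF that] bij_betw_same_card[OF that] by simp_all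
    moreover have "(\<forall>j\<in>{1..b}. B j \<subseteq> V \<and> card (B j) = k) \<longleftrightarrow> (\<forall>S\<in>Q. S \<subseteq> V \<and> card S = k)"
      unfolding bij_betw_imp_surj_on[OF that, symmetric] ball_simps ..
    ultimately show ?thesis
      by (simp only: block_design_def simp_thms
          count[OF that, of "\<lambda>S. x \<in> S" for x] count[OF that, of "\<lambda>S. {x, y} \<subseteq> S" for x y])
  qed
  show ?thesis
  proof
    assume "block_set_of_design V v b r k l Q"
    then obtain B where B: "bij_betw B {1..b} Q" and "block_design V v b r k l B"
      unfolding block_set_of_design_def by blast
    then show ?R
      unfolding eq[OF B] by blast
  next
    assume R: ?R
    then have "finite Q" "card Q = b"
      by blast+
    then have "\<exists>B. bij_betw B {1..b} Q"
      by (intro finite_same_card_bij) simp_all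
    then obtain B where B: "bij_betw B {1..b} Q" ..
    have "block_design V v b r k l B"
      unfolding eq[OF B] by (rule R)
    with B show "block_set_of_design V v b r k l Q"
      unfolding block_set_of_design_def by blast
  qed
qed

section \<open>Equivalent pairs and even quadruples\<close>

lemma Zplus_eq_iff:
  "Zplus b B x y = Zplus b B c d \<longleftrightarrow>
     (\<forall>j\<in>{1..b}. (x \<in> B j \<longleftrightarrow> y \<in> B j) \<longleftrightarrow> (c \<in> B j \<longleftrightarrow> d \<in> B j))"
proof -
  have *: "\<bar>indicator A x - indicator A y\<bar> = (if x \<in> A \<longleftrightarrow> y \<in> A then 0 else 1 :: int)"
    for A :: "'a set" and x y
    by (auto simp: indicator_def)
  show ?thesis
    unfolding Zplus_def * by (auto simp: fun_eq_iff restrict_def)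
qed

text \<open>A pair meets \<open>A\<close> in an odd number of points iff \<open>A\<close> separates
  it, so the total is even iff \<open>A\<close> separates both pairs or neither. This matches the
  coordinatewise condition for equality of the \<open>Zplus\<close> vectors.\<close>

lemma even_card_quadruple_Int:
  assumes "distinct [x, y, c, d]"
  shows "even (card ({x, y, c, d} \<inter> A)) \<longleftrightarrow> ((x \<in> A \<longleftrightarrow> y \<in> A) \<longleftrightarrow> (c \<in> A \<longleftrightarrow> d \<in> A))"
  using assms by (auto simp: Int_insert_left)

text \<open>If no block separated \<open>x\<close> and \<open>y\<close>, the blocks through
  \<open>x\<close> would be those through both, whence \<open>l = r\<close>. Then each block through
  \<open>x\<close> would contain every point, contradicting \<open>k < v\<close>.\<close>

lemma block_design_separates:
  assumes "block_design V v b r k l B" "x \<in> V" "y \<in> V" "x \<noteq> y"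
  obtains j where "j \<in> {1..b}" "x \<in> B j \<longleftrightarrow> y \<notin> B j"
proof (rule ccontr)
  assume "\<not> thesis"
  then have "{j\<in>{1..b}. {x, y} \<subseteq> B j} = {j\<in>{1..b}. x \<in> B j}"
    using that by blast
  then have "l = r"
    using assms unfolding block_design_def by metis
  \<comment> \<open>The reverse inclusion is clear and both finite sets have \<open>r = l\<close>
    elements, so they coincide.\<close>
  have sub: "{j\<in>{1..b}. x \<in> B j} \<subseteq> {j\<in>{1..b}. {x, z} \<subseteq> B j}" if "z \<in> V" "z \<noteq> x" for z
  proof -
    have "card {j\<in>{1..b}. {x, z} \<subseteq> B j} = card {j\<in>{1..b}. x \<in> B j}"
      using assms that \<open>l = r\<close> by (simp add: block_design_def)
    then have "{j\<in>{1..b}. {x, z} \<subseteq> B j} = {j\<in>{1..b}. x \<in> B j}"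
      by (intro card_subset_eq) auto
    then show ?thesis by blast
  qed
  have "card {j\<in>{1..b}. x \<in> B j} > 0"
    using assms by (simp add: block_design_def)
  then obtain j where j: "j \<in> {1..b}" "x \<in> B j"
    by (auto simp: card_gt_0_iff)
  have "V \<subseteq> B j"
    using sub j by blast
  then have "B j = V"
    using assms(1) j by (auto simp: block_design_def)
  then show False
    using assms(1) j by (auto simp: block_design_def)
qed

lemma block_design_unordered_pairs_nonempty:
  assumes "block_design V v b r k l B"
  shows "unordered_pairs V \<noteq> {}"
proof -
  have "\<not> is_singleton V" "V \<noteq> {}"
    using assms by (auto simp: block_design_def is_singleton_altdef)
  then obtain x y where "x \<in> V" "y \<in> V" "x \<noteq> y"
    by (metis ex_in_conv is_singletonI')
  then show ?thesis
    by (auto simp: unordered_pairs_def)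
qed

text \<open>A block separating \<open>y\<close> from \<open>z\<close> separates \<open>x\<close>
  from exactly one of them, so the two vectors would differ there.\<close>

lemma block_design_Zplus_cancel:
  assumes "block_design V v b r k l B" "y \<in> V" "z \<in> V"
    and "Zplus b B x y = Zplus b B x z"
  shows "y = z"
proof (rule ccontr)
  assume "y \<noteq> z"
  then obtain j where "j \<in> {1..b}" "y \<in> B j \<longleftrightarrow> z \<notin> B j"
    using block_design_separates[OF assms(1-3)] by blast
  then show False
    using assms(4) unfolding Zplus_eq_iff by blast
qed

lemma pair_equiv_disjoint:
  assumes D: "block_design V v b r k l B" and pq: "(p, q) \<in> pair_equiv V b B" "p \<noteq> q"
  shows "p \<inter> q = {}"
proof (rule ccontr)
  assume "p \<inter> q \<noteq> {}"
  then obtain x where x: "x \<in> p" "x \<in> q" by blast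
  have "p \<in> unordered_pairs V" "q \<in> unordered_pairs V"
    using pq by (auto simp: pair_equiv_def)
  with x obtain y z where yz: "p = {x, y}" "q = {x, z}" "y \<in> V" "z \<in> V"
    unfolding unordered_pairs_def by fastforce
  then have "Zplus b B x y = Zplus b B x z"
    using pq(1) by (simp add: pair_equiv_iff)
  then show False
    using block_design_Zplus_cancel[OF D] yz pq(2) by blast
qed

lemma pair_equiv_iff_even_quadruple:
  assumes "p \<in> unordered_pairs V" "q \<in> unordered_pairs V" "p \<inter> q = {}"
  shows "(p, q) \<in> pair_equiv V b B \<longleftrightarrow> p \<union> q \<in> even_quadruples V b B"
proof -
  obtain x y c d where e: "p = {x, y}" "q = {c, d}" and V: "{x, y, c, d} \<subseteq> V"
    and "x \<noteq> y" "c \<noteq> d"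
    using assms by (auto simp: unordered_pairs_def)
  then have dist: "distinct [x, y, c, d]"
    using assms(3) by auto
  have "p \<union> q = {x, y, c, d}" "card {x, y, c, d} = 4"
    using e dist by auto
  then show ?thesis
    using V assms(1,2) unfolding e
    by (simp add: pair_equiv_iff Zplus_eq_iff even_quadruples_def even_card_quadruple_Int[OF dist]
        del: Un_insert_left Un_insert_right)
qed

text \<open>The map taking \<open>q\<close> to \<open>p \<union> q\<close> is a bijection from the
  other members of the class onto the even quadruples containing \<open>p\<close>; its inverse
  removes \<open>p\<close>. The summand 1 counts \<open>p\<close> itself.\<close>

lemma card_pair_class:
  assumes D: "block_design V v b r k l B" and p: "p \<in> unordered_pairs V"
  shows "card (pair_equiv V b B `` {p}) = 1 + card {S\<in>even_quadruples V b B. p \<subseteq> S}"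
proof -
  let ?C = "pair_equiv V b B `` {p}" and ?Q = "{S\<in>even_quadruples V b B. p \<subseteq> S}"
  have "finite V"
    using D by (simp add: block_design_def)
  have sub: "?C \<subseteq> unordered_pairs V"
    by (auto simp: pair_equiv_def)
  have C: "q \<in> ?C - {p} \<longleftrightarrow> q \<in> unordered_pairs V \<and> p \<inter> q = {} \<and> p \<union> q \<in> even_quadruples V b B"
    for q
  proof
    assume "q \<in> ?C - {p}"
    then show "q \<in> unordered_pairs V \<and> p \<inter> q = {} \<and> p \<union> q \<in> even_quadruples V b B"
      using sub pair_equiv_disjoint[OF D, of p q] pair_equiv_iff_even_quadruple[OF p, of q] by auto
  next
    assume "q \<in> unordered_pairs V \<and> p \<inter> q = {} \<and> p \<union> q \<in> even_quadruples V b B"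
    \<comment> \<open>A nonempty \<open>p\<close> is not disjoint from itself, so
      \<open>p \<inter> q = {}\<close> already excludes \<open>q = p\<close>.\<close>
    moreover have "p \<noteq> {}"
      using p by (auto simp: unordered_pairs_def)
    ultimately show "q \<in> ?C - {p}"
      using pair_equiv_iff_even_quadruple[OF p, of q] by auto
  qed
  have "bij_betw (\<lambda>q. p \<union> q) (?C - {p}) ?Q"
  proof (rule bij_betw_byWitness[where f' = "\<lambda>S. S - p"])
    show "\<forall>q\<in>?C - {p}. p \<union> q - p = q"
      using C by blast
    show "\<forall>S\<in>?Q. p \<union> (S - p) = S"
      by blast
    show "(\<lambda>q. p \<union> q) ` (?C - {p}) \<subseteq> ?Q"
      using C by blast
    show "(\<lambda>S. S - p) ` ?Q \<subseteq> ?C - {p}"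
    proof (rule image_subsetI)
      fix S assume S: "S \<in> ?Q"
      have "card p = 2" "finite p"
        using p by (auto simp: unordered_pairs_def)
      then have "card (S - p) = 2"
        using S by (simp add: card_Diff_subset even_quadruples_def)
      then have "S - p \<in> unordered_pairs V"
        using S by (auto simp: card_2_iff unordered_pairs_def even_quadruples_def)
      moreover have "p \<union> (S - p) = S"
        using S by blast
      ultimately show "S - p \<in> ?C - {p}"
        unfolding C using S by auto
    qed
  qed
  then have "card (?C - {p}) = card ?Q"
    by (rule bij_betw_same_card)
  moreover have "p \<in> ?C"
    using p equiv_class_self[OF equiv_pair_equiv] by metis
  moreover have "finite ?C"
    using finite_subset[OF sub] finite_unordered_pairs[OF \<open>finite V\<close>] by blast
  ultimately show ?thesis
    using card.remove[of ?C p] by simp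
qed

section \<open>Class sizes and the parameters of a system of pairs\<close>

lemma card_pair_classes_iff:
  assumes "block_design V v b r k l B"
  shows "(\<forall>C\<in>pair_classes V b B. card C = 1 + m) \<longleftrightarrow>
    (\<forall>p\<in>unordered_pairs V. card {S\<in>even_quadruples V b B. p \<subseteq> S} = m)"
  unfolding pair_classes_def quotient_def using card_pair_class[OF assms] by simp

lemma pair_classes_nonempty:
  assumes "block_design V v b r k l B"
  shows "pair_classes V b B \<noteq> {}"
  using block_design_unordered_pairs_nonempty[OF assms] by (simp add: pair_classes_def)

lemma disjoint_pair_class:
  assumes D: "block_design V v b r k l B" and C: "C \<in> pair_classes V b B"
  shows "disjoint C"
proof (rule disjointI)
  fix p q assume "p \<in> C" "q \<in> C" "p \<noteq> q"
  then have "(p, q) \<in> pair_equiv V b B"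
    using C quotient_eq_iff[OF equiv_pair_equiv, of C V b B C p q] by (simp add: pair_classes_def)
  then show "p \<inter> q = {}"
    using pair_equiv_disjoint[OF D] \<open>p \<noteq> q\<close> by blast
qed

text \<open>The classes always partition the pairs, and each class is disjoint because the blocks
  separate points. Hence only equality of the class sizes is at stake; summing them yields
  \<open>n * t\<close>, which is positive since some pair exists.\<close>

lemma system_of_pairs_pair_classes_iff:
  assumes D: "block_design V v b r k l B"
  shows "system_of_pairs V v n t (pair_classes V b B) \<longleftrightarrow>
    card (pair_classes V b B) = n \<and> (\<forall>C\<in>pair_classes V b B. card C = t)"
proof -
  let ?P = "pair_classes V b B"
  have V: "finite V" "card V = v"
    using D by (auto simp: block_design_def)
  have part: "partition_on (unordered_pairs V) ?P"
    unfolding pair_classes_def by (rule partition_on_quotient[OF equiv_pair_equiv])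
  have fin: "finite ?P"
    using finite_elements[OF finite_unordered_pairs[OF V(1)] part] .
  have finC: "finite C" if "C \<in> ?P" for C
    using that partition_onD1[OF part] finite_unordered_pairs[OF V(1)]
    by (metis Sup_upper finite_subset)
  have "n \<ge> 1 \<and> t \<ge> 1 \<and> n * t = v * (v - 1) div 2"
    if n: "card ?P = n" and t: "\<forall>C\<in>?P. card C = t"
  proof -
    have "card (unordered_pairs V) = (\<Sum>C\<in>?P. card C)"
      by (rule product_partition[OF part finC])
    also have "\<dots> = n * t"
      using n t by simp
    finally have eq: "n * t = v * (v - 1) div 2"
      using card_unordered_pairs[OF V(1)] V(2) by simp
    have "card (unordered_pairs V) > 0"
      using block_design_unordered_pairs_nonempty[OF D] finite_unordered_pairs[OF V(1)]
      by (simp add: card_gt_0_iff)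
    then have "n * t > 0"
      using eq card_unordered_pairs[OF V(1)] V(2) by simp
    then have "n > 0" "t > 0" by simp_all
    with eq show ?thesis by simp
  qed
  then show ?thesis
    unfolding system_of_pairs_def using V part disjoint_pair_class[OF D] by blast
qed

section \<open>From constant pair counts to a design of quadruples\<close>

lemma block_set_of_design_even_quadruplesI:
  assumes fin: "finite V" and v: "card V \<noteq> 4" and ne: "even_quadruples V b B \<noteq> {}"
    and pairs: "\<forall>p\<in>unordered_pairs V. card {S\<in>even_quadruples V b B. p \<subseteq> S} = m"
  shows "block_set_of_design V (card V) (card (even_quadruples V b B))
           (m * (card V - 1) div 3) 4 m (even_quadruples V b B)"
proof -
  let ?Q = "even_quadruples V b B"
  have Q: "S \<subseteq> V" "card S = 4" "finite S" if "S \<in> ?Q" for S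
    using that fin by (auto simp: even_quadruples_def intro: finite_subset)
  have finQ: "finite ?Q"
    using finite_even_quadruples[OF fin] .
  obtain S where S: "S \<in> ?Q"
    using ne by blast
  have "card V \<ge> 4"
    using card_mono[OF fin Q(1)[OF S]] Q(2)[OF S] by simp
  \<comment> \<open>The excluded value 4 is what turns the bound into the strict inequality
    \<open>k < v\<close> required of a design.\<close>
  with v have "card V > 4" by simp
  \<comment> \<open>Any pair inside the quadruple \<open>S\<close> has a positive count, and all
    counts equal \<open>m\<close>.\<close>
  have "m > 0"
  proof -
    obtain x y where xy: "x \<in> S" "y \<in> S" "x \<noteq> y"
      using Q(2)[OF S] card_le_Suc0_iff_eq[OF Q(3)[OF S]] by auto
    then have "{x, y} \<in> unordered_pairs V"
      using Q(1)[OF S] by (auto simp: unordered_pairs_def)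
    with pairs have "card {S\<in>?Q. {x, y} \<subseteq> S} = m" by blast
    moreover have "S \<in> {S\<in>?Q. {x, y} \<subseteq> S}"
      using S xy by blast
    moreover have "finite {S\<in>?Q. {x, y} \<subseteq> S}"
      using finQ by simp
    ultimately show ?thesis
      using card_gt_0_iff by blast
  qed
  \<comment> \<open>Double count the pairs \<open>(y, S)\<close> with \<open>y \<noteq> x\<close>
    and both points in \<open>S\<close>: each quadruple through \<open>x\<close> has 3 further
    points, and each further point lies on \<open>m\<close> such quadruples.\<close>
  have points: "3 * card {S\<in>?Q. x \<in> S} = m * (card V - 1)" if "x \<in> V" for x
  proof -
    have "\<forall>S\<in>{S\<in>?Q. x \<in> S}. card {y\<in>V - {x}. y \<in> S} = 3"
    proof
      fix S assume S: "S \<in> {S\<in>?Q. x \<in> S}"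
      then have "{y\<in>V - {x}. y \<in> S} = S - {x}"
        using Q(1)[of S] by auto
      then show "card {y\<in>V - {x}. y \<in> S} = 3"
        using S Q[of S] by simp
    qed
    then have "(\<Sum>y\<in>V - {x}. card {S\<in>{S\<in>?Q. x \<in> S}. y \<in> S}) = 3 * card {S\<in>?Q. x \<in> S}"
      using fin finQ by (intro sum_multicount) auto
    moreover have "card {S\<in>{S\<in>?Q. x \<in> S}. y \<in> S} = m" if "y \<in> V - {x}" for y
    proof -
      have "{x, y} \<in> unordered_pairs V"
        using that \<open>x \<in> V\<close> by (auto simp: unordered_pairs_def)
      then have "card {S\<in>?Q. {x, y} \<subseteq> S} = m"
        using pairs by blast
      moreover have "{S\<in>{S\<in>?Q. x \<in> S}. y \<in> S} = {S\<in>?Q. {x, y} \<subseteq> S}"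
        by auto
      ultimately show ?thesis by simp
    qed
    ultimately show ?thesis
      using \<open>x \<in> V\<close> fin by (simp add: mult.commute)
  qed
  have "m * (card V - 1) div 3 > 0"
  proof -
    have "1 * 4 \<le> m * (card V - 1)"
      using \<open>m > 0\<close> \<open>card V > 4\<close> by (intro mult_le_mono) auto
    then show ?thesis by simp
  qed
  \<comment> \<open>By \<open>points\<close> the division by 3 is exact.\<close>
  moreover have "card {S\<in>?Q. x \<in> S} = m * (card V - 1) div 3" if "x \<in> V" for x
    using points[OF that] by simp
  moreover have "card {S\<in>?Q. {x, y} \<subseteq> S} = m" if "x \<in> V" "y \<in> V" "x \<noteq> y" for x y
  proof -
    have "{x, y} \<in> unordered_pairs V"
      using that by (auto simp: unordered_pairs_def)
    with pairs show ?thesis by blast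
  qed
  moreover have "card ?Q > 0"
    using finQ ne by (simp add: card_gt_0_iff)
  ultimately show ?thesis
    unfolding block_set_of_design_iff
    using \<open>m > 0\<close> \<open>card V > 4\<close> fin finQ Q by auto
qed

theorem theorem4:
  fixes V :: "'a set" and B :: "nat \<Rightarrow> 'a set" and v b r k l :: nat
  assumes "v \<noteq> 4"
    and "block_design V v b r k l B"
  shows "((\<exists>n t. system_of_pairs V v n t (pair_classes V b B)) \<longleftrightarrow>
            even_quadruples V b B = {} \<or>
            (\<exists>v4 b4 r4 k4 l4. block_set_of_design V v4 b4 r4 k4 l4 (even_quadruples V b B)))
       \<and> (even_quadruples V b B = {} \<longrightarrow>
            trivial_system_of_pairs V v (pair_classes V b B) \<and>
            (\<forall>n t. system_of_pairs V v n t (pair_classes V b B) \<longrightarrow> t = 1))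
       \<and> (\<forall>v4 b4 r4 k4 l4. block_set_of_design V v4 b4 r4 k4 l4 (even_quadruples V b B) \<longrightarrow>
            v4 = v \<and> k4 = 4 \<and> l4 > 0 \<and>
            (\<forall>C\<in>pair_classes V b B. card C = 1 + l4) \<and>
            (\<forall>n t. system_of_pairs V v n t (pair_classes V b B) \<longrightarrow> l4 = t - 1 \<and> t = 1 + l4))"
proof -
  let ?Q = "even_quadruples V b B" and ?P = "pair_classes V b B"
  note system_iff = system_of_pairs_pair_classes_iff[OF assms(2)]
  note card_iff = card_pair_classes_iff[OF assms(2)]
  have V: "finite V" "card V = v"
    using assms(2) by (auto simp: block_design_def)
  \<comment> \<open>An actual class is needed to read off \<open>t\<close>: a statement about all
    classes alone would not determine it.\<close>
  obtain C0 where C0: "C0 \<in> ?P"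
    using pair_classes_nonempty[OF assms(2)] by blast
  have empty: "\<forall>C\<in>?P. card C = 1" if "?Q = {}"
    using card_iff[of 0] that by simp
  have design: "v4 = v \<and> k4 = 4 \<and> l4 > 0 \<and> (\<forall>C\<in>?P. card C = 1 + l4)"
    if "block_set_of_design V v4 b4 r4 k4 l4 ?Q" for v4 b4 r4 k4 l4
  proof -
    note * = that[unfolded block_set_of_design_iff]
    from * have "card ?Q > 0" by blast
    then obtain S where S: "S \<in> ?Q"
      by (auto simp: card_gt_0_iff)
    then have "card S = k4"
      using * by blast
    then have "k4 = 4"
      using S by (simp add: even_quadruples_def)
    \<comment> \<open>The pair condition of the design is exactly the constant pair count with
      \<open>m = l4\<close>.\<close>
    moreover have "\<forall>p\<in>unordered_pairs V. card {S\<in>?Q. p \<subseteq> S} = l4"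
      using * unfolding unordered_pairs_def by blast
    then have "\<forall>C\<in>?P. card C = 1 + l4"
      by (simp only: card_iff)
    moreover have "v4 = v" "l4 > 0"
      using * V by blast+
    ultimately show ?thesis by blast
  qed
  have "\<exists>v4 b4 r4 k4 l4. block_set_of_design V v4 b4 r4 k4 l4 ?Q"
    if sys: "system_of_pairs V v n t ?P" and "?Q \<noteq> {}" for n t
  proof -
    have "t \<ge> 1" "\<forall>C\<in>?P. card C = t"
      using sys by (auto simp: system_of_pairs_def)
    \<comment> \<open>Since \<open>t \<ge> 1\<close>, the natural subtraction is not truncated and
      \<open>1 + (t - 1) = t\<close>.\<close>
    then have "\<forall>p\<in>unordered_pairs V. card {S\<in>?Q. p \<subseteq> S} = t - 1"
      using card_iff[of "t - 1"] by simp
    then show ?thesis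
      using block_set_of_design_even_quadruplesI[OF V(1) _ \<open>?Q \<noteq> {}\<close>] V(2) assms(1) by blast
  qed
  moreover have "\<exists>n t. system_of_pairs V v n t ?P"
    if "?Q = {} \<or> (\<exists>v4 b4 r4 k4 l4. block_set_of_design V v4 b4 r4 k4 l4 ?Q)"
  proof -
    \<comment> \<open>The common size is 1 if there are no even quadruples and \<open>1 + l4\<close>
      otherwise; \<open>n\<close> is then the number of classes.\<close>
    have "\<exists>m. \<forall>C\<in>?P. card C = m"
      using that empty design by blast
    then show ?thesis
      unfolding system_iff by blast
  qed
  ultimately have iff: "(\<exists>n t. system_of_pairs V v n t ?P) \<longleftrightarrow>
      ?Q = {} \<or> (\<exists>v4 b4 r4 k4 l4. block_set_of_design V v4 b4 r4 k4 l4 ?Q)"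
    by blast
  have size: "t = m" if "system_of_pairs V v n t ?P" "\<forall>C\<in>?P. card C = m" for n t m
  proof -
    have "card C0 = t"
      using that(1) C0 by (simp add: system_of_pairs_def)
    then show ?thesis
      using that(2) C0 by blast
  qed
  have trivial: "?Q = {} \<longrightarrow> trivial_system_of_pairs V v ?P \<and>
      (\<forall>n t. system_of_pairs V v n t ?P \<longrightarrow> t = 1)"
  proof (intro impI conjI allI)
    assume "?Q = {}"
    note one = empty[OF this]
    show "trivial_system_of_pairs V v ?P"
      unfolding trivial_system_of_pairs_def system_iff using one by blast
    show "t = 1" if "system_of_pairs V v n t ?P" for n t
      by (rule size[OF that one])
  qed
  have nontrivial: "v4 = v \<and> k4 = 4 \<and> l4 > 0 \<and> (\<forall>C\<in>?P. card C = 1 + l4) \<and>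
      (\<forall>n t. system_of_pairs V v n t ?P \<longrightarrow> l4 = t - 1 \<and> t = 1 + l4)"
    if "block_set_of_design V v4 b4 r4 k4 l4 ?Q" for v4 b4 r4 k4 l4
  proof -
    note d = design[OF that]
    have "l4 = t - 1 \<and> t = 1 + l4" if "system_of_pairs V v n t ?P" for n t
    proof -
      have "t = 1 + l4"
        using size[OF that] d by blast
      then show ?thesis by simp
    qed
    with d show ?thesis by blast
  qed
  show ?thesis
    by (rule conjI[OF iff conjI[OF trivial]]) (intro allI impI, erule nontrivial)
qed

end
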